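(* Let $\Lambda$ be a singly connected, locally convex $k$-graph and let $v_0\in\Lambda^0$ be a vertex emitting at least five colours, i.e. $|\mathsf{E}(v_0)|\ge 5$. Then the underlying undirected graph of the $1$-skeleton $\operatorname{Sk}_\Lambda$ contains a subdivision of the complete graph $K_5$; in particular $\operatorname{Sk}_\Lambda$ is non-planar.
   Context: Let $\mathbb{N}^k$ be the free abelian monoid with generators $\varepsilon_1,\dots,\varepsilon_k$ (with $0\in\mathbb{N}$). A $k$-graph is a countable category $\Lambda$ together with a functor $d\colon\Lambda\to\mathbb{N}^k$ satisfying the factorisation property: whenever $d(\lambda)=m+n$ there exist unique $\mu,\nu\in\Lambda$ with $d(\mu)=m$, $d(\nu)=n$ and $\lambda=\mu\nu$. Elements of $\Lambda$ are morphisms; $\mathrm{r},\mathrm{s}\colon\Lambda\to\Lambda^0$ are the range and source maps; $\Lambda^m:=d^{-1}(m)$, and $\Lambda^0=d^{-1}(0)$ is identified with the set of objects (vertices). The composite $\mu\nu$ is defined when $\mathrm{s}(\mu)=\mathrm{r}(\nu)$, and then $\mathrm{r}(\mu\nu)=\mathrm{r}(\mu)$, $\mathrm{s}(\mu\nu)=\mathrm{s}(\nu)$. Elements of $\Lambda^{\varepsilon_i}$ are edges of colour $i$. For $u,v\in\Lambda^0$ and $F\subseteq\Lambda$: $uF=\mathrm{r}^{-1}(u)\cap F$, $Fv=\mathrm{s}^{-1}(v)\cap F$, and $u\Lambda v=\mathrm{r}^{-1}(u)\cap\mathrm{s}^{-1}(v)$. The $1$-skeleton $\operatorname{Sk}_\Lambda$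 is the $k$-coloured directed graph with vertex set $\Lambda^0$ and edge set $\bigcup_{i\le k}\Lambda^{\varepsilon_i}$. It is planar if its underlying undirected graph admits a planar embedding. Singly connected: $|u\Lambda v|\le 1$ for all $u,v\in\Lambda^0$. Locally convex: for all $i\ne j$ and all $e\in\Lambda^{\varepsilon_i}$, $f\in\Lambda^{\varepsilon_j}$ with $\mathrm{r}(e)=\mathrm{r}(f)$, there exist $e'\in \mathrm{s}(f)\Lambda^{\varepsilon_i}$ and $f'\in \mathrm{s}(e)\Lambda^{\varepsilon_j}$ with $ef'=fe'$. For $v\in\Lambda^0$, $\mathsf{E}(v)=\{i\in\{1,\dots,k\}: v\Lambda^{\varepsilon_i}\neq\emptyset\}$; $v$ emits colour $i$ if $i\in\mathsf{E}(v)$, i.e. if there is a colour-$i$ edge with range $v$. *)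

theory Defs
  imports "HOL-Analysis.Analysis" "Graph_Theory.Kuratowski"
begin

section \<open>Higher-rank graphs\<close>

text \<open>
  A category is given by its morphisms only: an object is identified with its identity morphism,
  so that the range and source maps send morphisms to morphisms. The rank \<open>k\<close> is the cardinality
  of the finite colour type \<open>'k\<close>; the monoid \<open>\<nat>\<^sup>k\<close> is \<open>nat ^ 'k\<close>, with generators
  \<open>axis i 1\<close>.
\<close>

record ('a, 'k::finite) rank_graph =
  mor :: "'a set"
  rng :: "'a \<Rightarrow> 'a"
  src :: "'a \<Rightarrow> 'a"
  cmp :: "'a \<Rightarrow> 'a \<Rightarrow> 'a"
  deg :: "'a \<Rightarrow> nat ^ 'k"

locale countable_category =
  fixes \<Lambda> :: "('a, 'k::finite) rank_graph"
  assumes countable_mor: "countable (mor \<Lambda>)"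
    and rng_closed: "x \<in> mor \<Lambda> \<Longrightarrow> rng \<Lambda> x \<in> mor \<Lambda>"
    and src_closed: "x \<in> mor \<Lambda> \<Longrightarrow> src \<Lambda> x \<in> mor \<Lambda>"
    and rng_rng: "x \<in> mor \<Lambda> \<Longrightarrow> rng \<Lambda> (rng \<Lambda> x) = rng \<Lambda> x"
    and src_rng: "x \<in> mor \<Lambda> \<Longrightarrow> src \<Lambda> (rng \<Lambda> x) = rng \<Lambda> x"
    and rng_src: "x \<in> mor \<Lambda> \<Longrightarrow> rng \<Lambda> (src \<Lambda> x) = src \<Lambda> x"
    and src_src: "x \<in> mor \<Lambda> \<Longrightarrow> src \<Lambda> (src \<Lambda> x) = src \<Lambda> x"
    and cmp_closed: "\<lbrakk>x \<in> mor \<Lambda>; y \<in> mor \<Lambda>; src \<Lambda> x = rng \<Lambda> y\<rbrakk> \<Longrightarrow> cmp \<Lambda> x y \<in> mor \<Lambda>"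
    and rng_cmp: "\<lbrakk>x \<in> mor \<Lambda>; y \<in> mor \<Lambda>; src \<Lambda> x = rng \<Lambda> y\<rbrakk> \<Longrightarrow> rng \<Lambda> (cmp \<Lambda> x y) = rng \<Lambda> x"
    and src_cmp: "\<lbrakk>x \<in> mor \<Lambda>; y \<in> mor \<Lambda>; src \<Lambda> x = rng \<Lambda> y\<rbrakk> \<Longrightarrow> src \<Lambda> (cmp \<Lambda> x y) = src \<Lambda> y"
    and cmp_rng: "x \<in> mor \<Lambda> \<Longrightarrow> cmp \<Lambda> (rng \<Lambda> x) x = x"
    and cmp_src: "x \<in> mor \<Lambda> \<Longrightarrow> cmp \<Lambda> x (src \<Lambda> x) = x"
    and cmp_assoc: "\<lbrakk>x \<in> mor \<Lambda>; y \<in> mor \<Lambda>; z \<in> mor \<Lambda>; src \<Lambda> x = rng \<Lambda> y; src \<Lambda> y = rng \<Lambda> z\<rbrakk>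
      \<Longrightarrow> cmp \<Lambda> (cmp \<Lambda> x y) z = cmp \<Lambda> x (cmp \<Lambda> y z)"

locale k_graph = countable_category \<Lambda> for \<Lambda> :: "('a, 'k::finite) rank_graph" +
  assumes deg_rng: "x \<in> mor \<Lambda> \<Longrightarrow> deg \<Lambda> (rng \<Lambda> x) = 0"
    and deg_src: "x \<in> mor \<Lambda> \<Longrightarrow> deg \<Lambda> (src \<Lambda> x) = 0"
    and deg_cmp: "\<lbrakk>x \<in> mor \<Lambda>; y \<in> mor \<Lambda>; src \<Lambda> x = rng \<Lambda> y\<rbrakk>
      \<Longrightarrow> deg \<Lambda> (cmp \<Lambda> x y) = deg \<Lambda> x + deg \<Lambda> y"
    and factorisation: "\<lbrakk>x \<in> mor \<Lambda>; deg \<Lambda> x = m + n\<rbrakk>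
      \<Longrightarrow> \<exists>!(y, z). y \<in> mor \<Lambda> \<and> z \<in> mor \<Lambda> \<and> src \<Lambda> y = rng \<Lambda> z
            \<and> deg \<Lambda> y = m \<and> deg \<Lambda> z = n \<and> x = cmp \<Lambda> y z"

definition deg_class :: "('a, 'k::finite) rank_graph \<Rightarrow> nat ^ 'k \<Rightarrow> 'a set" where
  "deg_class \<Lambda> m = {x \<in> mor \<Lambda>. deg \<Lambda> x = m}"

definition objects :: "('a, 'k::finite) rank_graph \<Rightarrow> 'a set" where
  "objects \<Lambda> = deg_class \<Lambda> 0"

definition edges :: "('a, 'k::finite) rank_graph \<Rightarrow> 'k \<Rightarrow> 'a set" where
  "edges \<Lambda> i = deg_class \<Lambda> (axis i 1)"

lemma (in k_graph) objects_eq_identities: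
  "objects \<Lambda> = rng \<Lambda> ` mor \<Lambda>" "objects \<Lambda> = src \<Lambda> ` mor \<Lambda>"
proof -
  have id: "rng \<Lambda> x = x" "src \<Lambda> x = x" if "x \<in> objects \<Lambda>" for x
  proof -
    have x: "x \<in> mor \<Lambda>" "deg \<Lambda> x = 0"
      using that by (auto simp: objects_def deg_class_def)
    let ?P = "\<lambda>(y, z). y \<in> mor \<Lambda> \<and> z \<in> mor \<Lambda> \<and> src \<Lambda> y = rng \<Lambda> z
            \<and> deg \<Lambda> y = 0 \<and> deg \<Lambda> z = 0 \<and> x = cmp \<Lambda> y z"
    have ex: "\<exists>!p. ?P p"
      using factorisation[of x 0 0] x by simp
    have P1: "?P (rng \<Lambda> x, x)" and P2: "?P (x, src \<Lambda> x)"
      using x by (simp_all add: rng_closed src_closed src_rng rng_src deg_rng deg_src cmp_rng cmp_src)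
    have "(rng \<Lambda> x, x) = (x, src \<Lambda> x)"
      using ex P1 P2 by (elim ex1E) (metis (no_types, lifting))
    then show "rng \<Lambda> x = x" "src \<Lambda> x = x" by auto
  qed
  show "objects \<Lambda> = rng \<Lambda> ` mor \<Lambda>"
    using id(1) by (force simp: objects_def deg_class_def rng_closed deg_rng)
  show "objects \<Lambda> = src \<Lambda> ` mor \<Lambda>"
    using id(2) by (force simp: objects_def deg_class_def src_closed deg_src)
qed

text \<open>The finiteness conjunct is needed because \<open>card\<close> is 0 on infinite sets.\<close>

definition singly_connected :: "('a, 'k::finite) rank_graph \<Rightarrow> bool" where
  "singly_connected \<Lambda> \<longleftrightarrow> (\<forall>u \<in> objects \<Lambda>. \<forall>v \<in> objects \<Lambda>.
     finite {x \<in> mor \<Lambda>. rng \<Lambda> x = u \<and> src \<Lambda> x = v} \<and>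
     card {x \<in> mor \<Lambda>. rng \<Lambda> x = u \<and> src \<Lambda> x = v} \<le> 1)"

definition locally_convex :: "('a, 'k::finite) rank_graph \<Rightarrow> bool" where
  "locally_convex \<Lambda> \<longleftrightarrow> (\<forall>i j. i \<noteq> j \<longrightarrow>
     (\<forall>e \<in> edges \<Lambda> i. \<forall>f \<in> edges \<Lambda> j. rng \<Lambda> e = rng \<Lambda> f \<longrightarrow>
       (\<exists>e' \<in> edges \<Lambda> i. \<exists>f' \<in> edges \<Lambda> j.
          rng \<Lambda> e' = src \<Lambda> f \<and> rng \<Lambda> f' = src \<Lambda> e \<and> cmp \<Lambda> e f' = cmp \<Lambda> f e')))"

definition emitted_colours :: "('a, 'k::finite) rank_graph \<Rightarrow> 'a \<Rightarrow> 'k set" where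
  "emitted_colours \<Lambda> v = {i. {e \<in> edges \<Lambda> i. rng \<Lambda> e = v} \<noteq> {}}"

text \<open>The colour of an edge of the skeleton is recorded by its degree in \<open>\<Lambda>\<close>.\<close>

definition skeleton :: "('a, 'k::finite) rank_graph \<Rightarrow> ('a, 'a) pre_digraph" where
  "skeleton \<Lambda> = \<lparr>verts = objects \<Lambda>, arcs = (\<Union>i. edges \<Lambda> i), tail = src \<Lambda>, head = rng \<Lambda>\<rparr>"


section \<open>Subdivisions and planarity\<close>

text \<open>
  Undirected graphs are symmetric digraphs whose arcs are pairs of vertices. Parallel edges are
  merged by \<open>mk_symmetric\<close>, which does not affect whether a subdivision of \<open>K\<^sub>n\<close> is contained.
\<close>

definition underlying_graph :: "('a, 'b) pre_digraph \<Rightarrow> ('a, 'a \<times> 'a) pre_digraph" where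
  "underlying_graph G = with_proj (mk_symmetric G)"

definition contains_complete_subdivision :: "nat \<Rightarrow> ('a, 'b) pre_digraph \<Rightarrow> bool" where
  "contains_complete_subdivision n G \<longleftrightarrow>
     (\<exists>H. subgraph H G \<and> (\<exists>K rev_K rev_H. subdivision (K, rev_K) (H, rev_H) \<and> K\<^bsub>n\<^esub> K))"

text \<open>
  A drawing in the plane (the type \<open>complex\<close>) of the undirected multigraph obtained from \<open>G\<close> by
  forgetting orientations: every arc of \<open>G\<close> is drawn exactly once, and the direction in which its
  curve is traversed is immaterial. By injectivity of \<open>p\<close>, a \<open>simple_path\<close> is a closed curve
  exactly if the edge is a loop.
\<close>

definition planar_embedding ::
    "('a, 'b) pre_digraph \<Rightarrow> ('a \<Rightarrow> complex) \<Rightarrow> ('b \<Rightarrow> real \<Rightarrow> complex) \<Rightarrow> bool" where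
  "planar_embedding G p \<gamma> \<longleftrightarrow>
     inj_on p (verts G) \<and>
     (\<forall>e \<in> arcs G. simple_path (\<gamma> e) \<and>
        pathstart (\<gamma> e) = p (tail G e) \<and> pathfinish (\<gamma> e) = p (head G e) \<and>
        path_image (\<gamma> e) \<inter> p ` verts G = {p (tail G e), p (head G e)}) \<and>
     (\<forall>e \<in> arcs G. \<forall>f \<in> arcs G. e \<noteq> f \<longrightarrow>
        path_image (\<gamma> e) \<inter> path_image (\<gamma> f) \<subseteq> p ` verts G)"

definition planar :: "('a, 'b) pre_digraph \<Rightarrow> bool" where
  "planar G \<longleftrightarrow> (\<exists>p \<gamma>. planar_embedding G p \<gamma>)"

end

theory Submission
  imports Defs
begin

text \<open>
  Choose an edge of each of five colours with range \<open>v\<^sub>0\<close>, and for each pair of colours complete the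
  two chosen edges to a commuting square by local convexity. The vertex \<open>v\<^sub>0\<close>, the sources \<open>t {i}\<close> of
  the chosen edges and the sources \<open>t {i, j}\<close> of the diagonals of the squares are pairwise distinct:
  each is the source of a morphism with range \<open>v\<^sub>0\<close>, single connectedness makes this morphism unique,
  and the degrees of these morphisms differ (\<open>two_layers_of_cube_in_skeleton\<close>).

  The five vertices \<open>t {i}\<close>, joined pairwise through the ten vertices \<open>t {i, j}\<close>, form a subdivision
  of \<open>K\<^sub>5\<close> (\<open>contains_complete_subdivisionI\<close>).

  Instead of the subdivided \<open>K\<^sub>5\<close>, a subdivided complete bipartite graph with parts of size three
  in the same configuration shows that the skeleton is not planar
  (\<open>not_planar_if_two_layers_of_cube\<close>): two of the vertices \<open>t {i}\<close> are the ends of a theta curve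
  whose three arcs pass through the other three, and \<open>v\<^sub>0\<close> is adjacent to all of these. But no point
  off a theta curve can be joined to the interiors of all three arcs without touching the other arcs
  (\<open>theta_curve_no_common_accessible_point\<close>), which follows from the Jordan curve theorem and
  Janiszewski's theorem.
\<close>

section \<open>Theta curves\<close>

text \<open>
  If \<open>c\<close> could be joined to the interiors of all three arcs of a theta curve, then the interior
  of each arc, together with its connection to \<open>c\<close>, would lie on the side of \<open>c\<close> with respect to the closed
  curve formed by the other two arcs. Choose \<open>q\<close> on the other side of one of these closed curves,
  \<open>Q i \<union> Q j\<close>. Its side has all of \<open>Q i \<union> Q j\<close> as frontier, so \<open>q\<close> reaches the interior of
  either arc, and from there \<open>c\<close>, without meeting the other one or \<open>Q k\<close>. As \<open>Q j \<union> Q k\<close> and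
  \<open>Q i \<union> Q k\<close> meet in the connected set \<open>Q k\<close>, Janiszewski's theorem connects \<open>q\<close> to \<open>c\<close> off the
  whole theta curve, a contradiction. The qualified name of topological connectedness distinguishes
  it from the connectedness of graphs.
\<close>

lemma theta_curve_no_common_accessible_point:
  fixes g :: "'i \<Rightarrow> real \<Rightarrow> complex" and R :: "'i \<Rightarrow> complex set"
  assumes dist: "distinct [i, j, k]"
    and arcs: "\<And>l. l \<in> {i, j, k} \<Longrightarrow> arc (g l) \<and> pathstart (g l) = a \<and> pathfinish (g l) = b"
    and theta: "\<And>l m. \<lbrakk>l \<in> {i, j, k}; m \<in> {i, j, k}; l \<noteq> m\<rbrakk>
      \<Longrightarrow> path_image (g l) \<inter> path_image (g m) \<subseteq> {a, b}"
    and conn: "\<And>l. l \<in> {i, j, k} \<Longrightarrow> topological_space_class.connected (R l) \<and> c \<in> R l"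
    and access: "\<And>l. l \<in> {i, j, k} \<Longrightarrow> R l \<inter> (path_image (g l) - {a, b}) \<noteq> {}"
    and avoid: "\<And>l m. \<lbrakk>l \<in> {i, j, k}; m \<in> {i, j, k}; l \<noteq> m\<rbrakk> \<Longrightarrow> R l \<inter> path_image (g m) = {}"
  shows False
proof -
  define Q where "Q l = path_image (g l)" for l
  define T where "T l = R l \<union> (Q l - {a, b})" for l
  have ab: "a \<in> Q l" "b \<in> Q l" and Q_compact: "compact (Q l)" and Q_conn: "topological_space_class.connected (Q l)"
    and Q_open: "topological_space_class.connected (Q l - {a, b})" if "l \<in> {i, j, k}" for l
    using arcs[OF that] connected_simple_path_endless[of "g l"]
    by (auto simp: Q_def arc_imp_simple_path arc_imp_path compact_path_image connected_path_image)
  have T_conn: "topological_space_class.connected (T l)" and cT: "c \<in> T l" if "l \<in> {i, j, k}" for l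
    using conn[OF that] access[OF that] Q_open[OF that] unfolding T_def Q_def
    by (auto intro!: connected_Un)
  have T_avoid: "T l \<inter> Q m = {}" if "l \<in> {i, j, k}" "m \<in> {i, j, k}" "l \<noteq> m" for l m
    using avoid[OF that] theta[OF that] by (auto simp: T_def Q_def)
  have ijk: "i \<noteq> j" "i \<noteq> k" "j \<noteq> k" using dist by auto
  have "simple_path (g i +++ reversepath (g j))"
    using arcs theta[of i j] ijk by (intro simple_path_join_loop) (auto simp: arc_reversepath)
  moreover have "pathfinish (g i +++ reversepath (g j)) = pathstart (g i +++ reversepath (g j))"
    using arcs by simp
  moreover have "path_image (g i +++ reversepath (g j)) = Q i \<union> Q j"
    using arcs by (simp add: path_image_join Q_def)
  ultimately obtain inner outer where sides:
    "inner \<noteq> {}" "open inner" "topological_space_class.connected inner" "frontier inner = Q i \<union> Q j"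
    "outer \<noteq> {}" "open outer" "topological_space_class.connected outer" "frontier outer = Q i \<union> Q j"
    "inner \<inter> outer = {}" "inner \<union> outer = - (Q i \<union> Q j)"
    using Jordan_curve by metis
  have "c \<in> inner \<union> outer"
    using T_avoid[of k i] T_avoid[of k j] cT[of k] ijk unfolding sides(10) by auto
  \<comment> \<open>\<open>D\<close> is the side of the closed curve \<open>Q i \<union> Q j\<close> that does not contain \<open>c\<close>.\<close>
  then obtain C D where CD: "open C" "open D" "c \<in> C" "D \<noteq> {}" "topological_space_class.connected D"
    "frontier D = Q i \<union> Q j" "C \<inter> D = {}" "C \<union> D = - (Q i \<union> Q j)"
    using sides by (metis Un_commute Int_commute UnE)
  then obtain q where q: "q \<in> D" by blast
  have same_side: "A \<inter> D = {}"
    if "topological_space_class.connected A" "c \<in> A" "A \<subseteq> - (Q i \<union> Q j)" for A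
    using connectedD[OF that(1) CD(1,2)] CD that by blast
  have "T k \<inter> D = {}"
    using same_side[of "T k"] T_conn cT T_avoid[of k i] T_avoid[of k j] ijk by auto
  then have DQ: "D \<inter> Q l = {}" if "l \<in> {i, j, k}" for l
    using that ab[of i] CD(8) unfolding T_def by auto
  have reach: "connected_component (- (Q m \<union> Q k)) c q" if "l \<in> {i, j}" "m \<in> {i, j}" "l \<noteq> m" for l m
  proof -
    have l: "l \<in> {i, j, k}" "m \<in> {i, j, k}" "l \<noteq> k" using that ijk by auto
    have "Q l \<subseteq> closure D"
      using CD(6) that(1) by (auto simp: frontier_def)
    then have "topological_space_class.connected (D \<union> (Q l - {a, b}))"
      using closure_subset[of D]
      by (intro connected_intermediate_closure[OF CD(5)]) auto
    moreover have "(D \<union> (Q l - {a, b})) \<inter> T l \<noteq> {}"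
      using access[OF l(1)] by (auto simp: T_def Q_def)
    ultimately have "topological_space_class.connected ((D \<union> (Q l - {a, b})) \<union> T l)"
      using T_conn[OF l(1)] connected_Un by blast
    moreover have "(D \<union> (Q l - {a, b})) \<union> T l \<subseteq> - (Q m \<union> Q k)"
      using DQ[OF l(2)] DQ[of k] T_avoid[OF l(1,2) that(3)] T_avoid[OF l(1) _ l(3)]
      by (auto simp: T_def)
    ultimately show ?thesis
      using q cT[OF l(1)] unfolding connected_component_def by blast
  qed
  have "(Q j \<union> Q k) \<inter> (Q i \<union> Q k) = Q k"
    using theta[of i j] ijk ab[of k] unfolding Q_def by blast
  then have common: "topological_space_class.connected ((Q j \<union> Q k) \<inter> (Q i \<union> Q k))"
    using Q_conn[of k] by simp
  have "connected_component (- ((Q j \<union> Q k) \<union> (Q i \<union> Q k))) c q"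
    by (rule Janiszewski_weak[OF _ _ common reach[of i j] reach[of j i]])
       (use ijk Q_compact in \<open>simp_all add: compact_Un\<close>)
  then obtain A where "topological_space_class.connected A" "A \<subseteq> - ((Q j \<union> Q k) \<union> (Q i \<union> Q k))" "c \<in> A" "q \<in> A"
    unfolding connected_component_def by blast
  then show False
    using same_side[of A] q by auto
qed

section \<open>Subdivisions of complete graphs\<close>

text \<open>
  The complete graph on \<open>x ` I\<close>, with the edge between \<open>x i\<close> and \<open>x j\<close> subdivided by the new vertex
  \<open>w {i, j}\<close> for every pair \<open>{i, j}\<close> in the family \<open>\<S>\<close>. Indexing by unordered pairs avoids the choice
  of an orientation of the edges.
\<close>

lemma subdivision_pair_complete:
  fixes x :: "'i \<Rightarrow> 'a" and w :: "'i set \<Rightarrow> 'a" and I :: "'i set"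
  defines "arcs_of \<equiv> \<lambda>\<S>. {(x i, x j) |i j. i \<in> I \<and> j \<in> I \<and> i \<noteq> j \<and> {i, j} \<notin> \<S>}
    \<union> {(x i, w S) |i S. i \<in> S \<and> S \<in> \<S>} \<union> {(w S, x i) |i S. i \<in> S \<and> S \<in> \<S>}"
  assumes x: "inj_on x I" and w: "inj_on w \<S>" and xw: "x ` I \<inter> w ` \<S> = {}"
    and \<S>: "finite \<S>" "\<S> \<subseteq> {S. S \<subseteq> I \<and> card S = 2}"
  shows "subdivision_pair \<lparr>pverts = x ` I, parcs = {(u, v). u \<in> x ` I \<and> v \<in> x ` I \<and> u \<noteq> v}\<rparr>
    \<lparr>pverts = x ` I \<union> w ` \<S>, parcs = arcs_of \<S>\<rparr>"
  using \<S>(1) w xw \<S>(2)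
proof (induction \<S> rule: finite_induct)
  case empty
  have "arcs_of {} = {(u, v). u \<in> x ` I \<and> v \<in> x ` I \<and> u \<noteq> v}"
    using x by (auto simp: arcs_of_def inj_on_eq_iff)
  moreover have "pair_bidirected_digraph
      \<lparr>pverts = x ` I, parcs = {(u, v). u \<in> x ` I \<and> v \<in> x ` I \<and> u \<noteq> v}\<rparr>"
    by unfold_locales (auto simp: symmetric_def sym_def)
  ultimately show ?case by (simp only: subdivision_pair_base image_empty Un_empty_right)
next
  case (insert S \<S>)
  obtain i j where S: "S = {i, j}" "i \<noteq> j" "i \<in> I" "j \<in> I"
    using insert.prems(3) by (auto simp: card_2_iff)
  let ?H = "\<lparr>pverts = x ` I \<union> w ` \<S>, parcs = arcs_of \<S>\<rparr>"
  have IH: "subdivision_pair \<lparr>pverts = x ` I, parcs = {(u, v). u \<in> x ` I \<and> v \<in> x ` I \<and> u \<noteq> v}\<rparr> ?H"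
    using insert by (intro insert.IH) auto
  have e: "(x i, x j) \<in> parcs ?H"
    using S insert.hyps(2) by (auto simp: arcs_of_def)
  have fresh: "w S \<notin> pverts ?H"
    using insert.prems insert.hyps(2) by auto
  have old: "w S' \<notin> x ` I" if "S' \<in> \<S>" for S'
    using insert.prems(2) that by auto
  have same: "{i', j'} = S \<longleftrightarrow> x i' = x i \<and> x j' = x j \<or> x i' = x j \<and> x j' = x i"
    if "i' \<in> I" "j' \<in> I" for i' j'
    using that S x by (auto simp: inj_on_eq_iff doubleton_eq_iff)
  have "arcs_of (insert S \<S>) = arcs_of \<S> - {(x i, x j), (x j, x i)}
      \<union> {(x i, w S), (w S, x i), (x j, w S), (w S, x j)}"
  proof -
    have 1: "{(x i', x j') |i' j'. i' \<in> I \<and> j' \<in> I \<and> i' \<noteq> j' \<and> {i', j'} \<notin> insert S \<S>}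
      = {(x i', x j') |i' j'. i' \<in> I \<and> j' \<in> I \<and> i' \<noteq> j' \<and> {i', j'} \<notin> \<S>} - {(x i, x j), (x j, x i)}"
      using same by fastforce
    have 2: "{(x i, w S) |i S. i \<in> S \<and> S \<in> \<S>} \<inter> {(x i, x j), (x j, x i)} = {}"
      "{(w S, x i) |i S. i \<in> S \<and> S \<in> \<S>} \<inter> {(x i, x j), (x j, x i)} = {}"
      using old S by force+
    have 3: "{(x i, w S') |i S'. i \<in> S' \<and> S' \<in> insert S \<S>}
       = {(x i, w S) |i S. i \<in> S \<and> S \<in> \<S>} \<union> {(x i, w S), (x j, w S)}"
      "{(w S', x i) |i S'. i \<in> S' \<and> S' \<in> insert S \<S>}
       = {(w S, x i) |i S. i \<in> S \<and> S \<in> \<S>} \<union> {(w S, x i), (w S, x j)}"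
      using S by auto
    show ?thesis
      unfolding arcs_of_def 1 3 using 2 by blast
  qed
  then have "\<lparr>pverts = x ` I \<union> w ` insert S \<S>, parcs = arcs_of (insert S \<S>)\<rparr>
      = subdivide ?H (x i, x j) (w S)"
    by (auto simp: subdivide.simps)
  then show ?case
    using subdivision_pair_divide[OF e fresh IH] by simp
qed

text \<open>
  The bound \<open>n \<ge> 2\<close> ensures that every \<open>x i\<close> occurs as the end of an arc and hence is a vertex.
\<close>

lemma contains_complete_subdivisionI:
  fixes x :: "'i \<Rightarrow> 'a" and w :: "'i set \<Rightarrow> 'a" and G :: "('a, 'b) pre_digraph"
  assumes G: "wf_digraph G" and I: "finite I" "card I = n" "n \<ge> 2"
    and x: "inj_on x I" and w: "inj_on w {S. S \<subseteq> I \<and> card S = 2}"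
    and xw: "x ` I \<inter> w ` {S. S \<subseteq> I \<and> card S = 2} = {}"
    and adj: "\<And>i S. \<lbrakk>i \<in> S; S \<subseteq> I; card S = 2\<rbrakk> \<Longrightarrow> \<exists>e \<in> arcs G. {tail G e, head G e} = {x i, w S}"
  shows "contains_complete_subdivision n (underlying_graph G)"
proof -
  interpret wf_digraph G by fact
  let ?\<S> = "{S. S \<subseteq> I \<and> card S = 2}"
  let ?K = "\<lparr>pverts = x ` I, parcs = {(u, v). u \<in> x ` I \<and> v \<in> x ` I \<and> u \<noteq> v}\<rparr>"
  let ?A = "{(x i, w S) |i S. i \<in> S \<and> S \<in> ?\<S>} \<union> {(w S, x i) |i S. i \<in> S \<and> S \<in> ?\<S>}"
  let ?H = "\<lparr>pverts = x ` I \<union> w ` ?\<S>, parcs = ?A\<rparr>"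
  have none: "{(x i, x j) |i j. i \<in> I \<and> j \<in> I \<and> i \<noteq> j \<and> {i, j} \<notin> ?\<S>} = {}"
    by (auto simp: card_insert_if)
  have "subdivision_pair ?K ?H"
    using subdivision_pair_complete[OF x w xw] I(1) unfolding none by simp
  moreover have "K\<^bsub>n\<^esub> (with_proj ?K)"
    using I x by (auto simp: complete_digraph_pair_def card_image)
  moreover have "subgraph (with_proj ?H) (underlying_graph G)"
  proof -
    have A: "?A \<subseteq> parcs (mk_symmetric G)"
    proof -
      have "(x i, w S) \<in> parcs (mk_symmetric G) \<and> (w S, x i) \<in> parcs (mk_symmetric G)"
        if "i \<in> S" "S \<in> ?\<S>" for i S
        using adj[of i S] that by (force simp: parcs_mk_symmetric doubleton_eq_iff)
      then show ?thesis by blast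
    qed
    have sym: "pair_wf_digraph (mk_symmetric G)" by (rule wellformed_mk_symmetric)
    have ends: "x i \<in> verts G \<and> w S \<in> verts G" if "i \<in> S" "S \<in> ?\<S>" for i S
    proof -
      obtain e where "e \<in> arcs G" "{tail G e, head G e} = {x i, w S}"
        using adj[of i S] \<open>i \<in> S\<close> \<open>S \<in> ?\<S>\<close> by auto
      then show ?thesis using tail_in_verts head_in_verts by (metis insert_subset empty_subsetI)
    qed
    have "\<exists>S. i \<in> S \<and> S \<in> ?\<S>" if "i \<in> I" for i
    proof -
      have "\<not> I \<subseteq> {i}" using I card_mono[of "{i}" I] by auto
      then obtain j where "j \<in> I" "j \<noteq> i" using that by fast
      then show ?thesis using that by (intro exI[of _ "{i, j}"]) auto
    qed
    moreover have "\<exists>i. i \<in> S" if "S \<in> ?\<S>" for S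
      using that by (auto simp: card_2_iff)
    ultimately have V: "x ` I \<union> w ` ?\<S> \<subseteq> verts G"
      using ends by blast
    have wfU: "wf_digraph (with_proj (mk_symmetric G))"
      using sym by (simp add: wf_digraph_def pair_wf_digraph_def)
    have wfH: "wf_digraph (with_proj ?H)"
      by unfold_locales auto
    show ?thesis
      unfolding underlying_graph_def using A V wfU wfH
      by (intro subgraphI) (auto simp: compatible_def)
  qed
  ultimately show ?thesis
    unfolding contains_complete_subdivision_def by blast
qed

section \<open>Planar embeddings\<close>

text \<open>The vertices that are incident with a set of arcs.\<close>

definition edge_ends :: "('a, 'b) pre_digraph \<Rightarrow> 'b set \<Rightarrow> 'a set" where
  "edge_ends G E = (\<Union>e\<in>E. {tail G e, head G e})"

text \<open>The part of the plane that the curves of a set of arcs occupy.\<close>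

definition drawing :: "('b \<Rightarrow> real \<Rightarrow> complex) \<Rightarrow> 'b set \<Rightarrow> complex set" where
  "drawing \<gamma> E = (\<Union>e\<in>E. path_image (\<gamma> e))"

text \<open>
  The curves of the arcs in \<open>E\<close> together form a topological arc from \<open>u\<close> to \<open>v\<close>; the arcs may be
  traversed in either direction. Loops are excluded so that arc sets with at most one common end are
  disjoint, as joining such arc sets requires.
\<close>

definition drawn_as_arc :: "('a, 'b) pre_digraph \<Rightarrow> ('a \<Rightarrow> complex) \<Rightarrow> ('b \<Rightarrow> real \<Rightarrow> complex)
    \<Rightarrow> 'b set \<Rightarrow> 'a \<Rightarrow> 'a \<Rightarrow> bool" where
  "drawn_as_arc G p \<gamma> E u v \<longleftrightarrow> E \<subseteq> {e \<in> arcs G. tail G e \<noteq> head G e} \<and>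
     (\<exists>g. arc g \<and> pathstart g = p u \<and> pathfinish g = p v \<and> path_image g = drawing \<gamma> E)"

lemma edge_ends_Un: "edge_ends G (E \<union> F) = edge_ends G E \<union> edge_ends G F"
  by (auto simp: edge_ends_def)

lemma planar_embedding_ends_in_drawing:
  assumes "planar_embedding G p \<gamma>" "E \<subseteq> arcs G"
  shows "p ` edge_ends G E \<subseteq> drawing \<gamma> E"
  using assms unfolding planar_embedding_def edge_ends_def drawing_def
  by (fastforce simp: subset_iff)

lemma planar_embedding_drawing_Int:
  assumes emb: "planar_embedding G p \<gamma>" and wf: "wf_digraph G"
    and EF: "E \<subseteq> arcs G" "F \<subseteq> arcs G" "E \<inter> F = {}"
  shows "drawing \<gamma> E \<inter> drawing \<gamma> F \<subseteq> p ` (edge_ends G E \<inter> edge_ends G F)"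
proof
  interpret wf_digraph G by fact
  fix z assume "z \<in> drawing \<gamma> E \<inter> drawing \<gamma> F"
  then obtain e f where e: "e \<in> E" "z \<in> path_image (\<gamma> e)" and f: "f \<in> F" "z \<in> path_image (\<gamma> f)"
    by (auto simp: drawing_def)
  have ef: "e \<in> arcs G" "f \<in> arcs G" "e \<noteq> f" using e f EF by auto
  then have "z \<in> p ` verts G"
    using emb e f unfolding planar_embedding_def by blast
  then have "z \<in> {p (tail G e), p (head G e)}" "z \<in> {p (tail G f), p (head G f)}"
    using emb e f ef unfolding planar_embedding_def by blast+
  then obtain u v where uv: "z = p u" "u \<in> {tail G e, head G e}" "z = p v" "v \<in> {tail G f, head G f}"
    by blast
  then have "u \<in> verts G" "v \<in> verts G" using ef by auto
  then have "u = v" using emb uv unfolding planar_embedding_def inj_on_def by metis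
  then show "z \<in> p ` (edge_ends G E \<inter> edge_ends G F)"
    using uv e f by (auto simp: edge_ends_def)
qed

lemma drawn_as_arc_single:
  assumes "planar_embedding G p \<gamma>" "wf_digraph G" "e \<in> arcs G" "{tail G e, head G e} = {u, v}" "u \<noteq> v"
  shows "drawn_as_arc G p \<gamma> {e} u v"
proof -
  have g: "simple_path (\<gamma> e)" "pathstart (\<gamma> e) = p (tail G e)" "pathfinish (\<gamma> e) = p (head G e)"
    using assms unfolding planar_embedding_def by auto
  have ne: "tail G e \<noteq> head G e" using assms by (auto simp: doubleton_eq_iff)
  moreover have "inj_on p (verts G)" using assms unfolding planar_embedding_def by auto
  ultimately have "p (tail G e) \<noteq> p (head G e)"
    using assms(2,3) by (simp add: inj_on_eq_iff wf_digraph.tail_in_verts wf_digraph.head_in_verts)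
  then have arc: "arc (\<gamma> e)" using g by (simp add: arc_simple_path)
  have "\<exists>g. arc g \<and> pathstart g = p u \<and> pathfinish g = p v \<and> path_image g = path_image (\<gamma> e)"
  proof (cases "u = tail G e")
    case True
    then show ?thesis using assms arc g by (intro exI[of _ "\<gamma> e"]) (auto simp: doubleton_eq_iff)
  next
    case False
    then show ?thesis using assms arc g
      by (intro exI[of _ "reversepath (\<gamma> e)"]) (auto simp: doubleton_eq_iff arc_reversepath)
  qed
  then show ?thesis using assms(3) ne by (simp add: drawn_as_arc_def drawing_def)
qed

lemma drawn_as_arc_join:
  assumes emb: "planar_embedding G p \<gamma>" "wf_digraph G"
    and E: "drawn_as_arc G p \<gamma> E u v" and F: "drawn_as_arc G p \<gamma> F v w"
    and EF: "edge_ends G E \<inter> edge_ends G F \<subseteq> {v}"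
  shows "drawn_as_arc G p \<gamma> (E \<union> F) u w"
proof -
  obtain g h where g: "arc g" "pathstart g = p u" "pathfinish g = p v" "path_image g = drawing \<gamma> E"
    and h: "arc h" "pathstart h = p v" "pathfinish h = p w" "path_image h = drawing \<gamma> F"
    using E F unfolding drawn_as_arc_def by blast
  have sub: "E \<subseteq> {e \<in> arcs G. tail G e \<noteq> head G e}" "F \<subseteq> {e \<in> arcs G. tail G e \<noteq> head G e}"
    using E F unfolding drawn_as_arc_def by auto
  have "E \<inter> F = {}"
    using sub EF unfolding edge_ends_def by blast
  then have "path_image g \<inter> path_image h \<subseteq> {pathstart h}"
    using planar_embedding_drawing_Int[OF emb, of E F] sub EF unfolding g h by blast
  then have "arc (g +++ h)" using g h by (intro arc_join) auto
  moreover have "path_image (g +++ h) = drawing \<gamma> (E \<union> F)"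
    using g h by (simp add: path_image_join drawing_def)
  ultimately show ?thesis
    using sub g h unfolding drawn_as_arc_def
    by (intro conjI exI[of _ "g +++ h"]) auto
qed

text \<open>
  The vertices \<open>t S\<close> are those of the three lowest levels of a cube of dimension \<open>card I\<close>, and the
  two layers of edges between these levels are present. Among five directions \<open>a, b, i, j, k\<close> they
  contain a subdivision of the complete bipartite graph with two parts of size three: one part is
  \<open>t {}, t {a}, t {b}\<close>, the other \<open>t {i}, t {j}, t {k}\<close>. The paths from \<open>t {a}\<close> through \<open>t {l}\<close> to
  \<open>t {b}\<close>, for \<open>l\<close> among \<open>i, j, k\<close>, form a theta curve, and \<open>t {}\<close> is adjacent to the inner vertex
  \<open>t {l}\<close> of each.
\<close>

lemma not_planar_if_two_layers_of_cube:
  fixes G :: "('a, 'b) pre_digraph" and t :: "'i set \<Rightarrow> 'a"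
  assumes wf: "wf_digraph G" and I: "card I \<ge> 5"
    and t: "inj_on t {S. S \<subseteq> I \<and> card S \<le> 2}"
    and adj: "\<And>S i. \<lbrakk>S \<subseteq> I; card S \<le> 1; i \<in> I - S\<rbrakk>
      \<Longrightarrow> \<exists>e \<in> arcs G. {tail G e, head G e} = {t S, t (insert i S)}"
  shows "\<not> planar G"
proof
  assume "planar G"
  then obtain p \<gamma> where emb: "planar_embedding G p \<gamma>" by (auto simp: planar_def)
  then have p_inj: "inj_on p (verts G)" by (simp add: planar_embedding_def)
  obtain J where "J \<subseteq> I" "card J = 5" using I by (meson obtain_subset_with_card_n)
  then obtain xs where xs: "set xs \<subseteq> I" "distinct xs" "length xs = 5"
    by (metis card.infinite distinct_card finite_distinct_list zero_neq_numeral)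
  then obtain a b i j k where "xs = [a, b, i, j, k]"
    by (auto simp: length_Suc_conv numeral_eq_Suc)
  with xs have "distinct [a, b, i, j, k]" "{a, b, i, j, k} \<subseteq> I" by auto
  then have dist: "a \<noteq> b" "distinct [i, j, k]" "a \<notin> {i, j, k}" "b \<notin> {i, j, k}"
    and sub: "a \<in> I" "b \<in> I" "{i, j, k} \<subseteq> I" by auto
  have t_eq [simp]: "t S = t S' \<longleftrightarrow> S = S'"
    if "S \<subseteq> I" "card S \<le> 2" "S' \<subseteq> I" "card S' \<le> 2" for S S'
    using inj_on_eq_iff[OF t] that by auto
  define ed where "ed S l = (SOME e. e \<in> arcs G \<and> {tail G e, head G e} = {t S, t (insert l S)})" for S l
  have ed: "ed S l \<in> arcs G" "{tail G (ed S l), head G (ed S l)} = {t S, t (insert l S)}"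
    if "S \<subseteq> I" "card S \<le> 1" "l \<in> I - S" for S l
    using someI_ex[OF adj[OF that, unfolded Bex_def]] unfolding ed_def by auto
  define F where "F l = {ed {a} l} \<union> ({ed {l} a} \<union> ({ed {l} b} \<union> {ed {b} l}))" for l
  \<comment> \<open>\<open>F l\<close> is the path \<open>t {a}, t {a, l}, t {l}, t {b, l}, t {b}\<close>.\<close>
  have ends: "edge_ends G {ed {a} l} = {t {a}, t {a, l}}" "edge_ends G {ed {l} a} = {t {l}, t {a, l}}"
      "edge_ends G {ed {l} b} = {t {l}, t {b, l}}" "edge_ends G {ed {b} l} = {t {b}, t {b, l}}"
      "edge_ends G {ed {} l} = {t {}, t {l}}"
    if "l \<in> {i, j, k}" for l
    using that sub dist ed(2)[of "{a}" l] ed(2)[of "{l}" a] ed(2)[of "{l}" b] ed(2)[of "{b}" l]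
      ed(2)[of "{}" l]
    by (auto simp: edge_ends_def insert_commute)
  have ends_F: "edge_ends G (F l) = {t {a}, t {a, l}, t {l}, t {b, l}, t {b}}" if "l \<in> {i, j, k}" for l
    unfolding F_def edge_ends_Un ends[OF that] by blast
  have mid_F: "t {a, l} \<in> edge_ends G {e} \<or> t {b, l} \<in> edge_ends G {e}" if "l \<in> {i, j, k}" "e \<in> F l" for l e
    using that(2) ends[OF that(1)] by (auto simp: F_def)
  have ends_mono: "edge_ends G {e} \<subseteq> edge_ends G E" if "e \<in> E" for e E
    using that by (auto simp: edge_ends_def)
  have F_arcs: "F l \<subseteq> arcs G" if "l \<in> {i, j, k}" for l
    using that sub dist ed(1) by (auto simp: F_def)
  have drawn: "drawn_as_arc G p \<gamma> (F l) (t {a}) (t {b})" if l: "l \<in> {i, j, k}" for l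
  proof -
    have l': "l \<in> I" "l \<noteq> a" "l \<noteq> b" using l sub dist by auto
    have s: "drawn_as_arc G p \<gamma> {ed {a} l} (t {a}) (t {a, l})"
      "drawn_as_arc G p \<gamma> {ed {l} a} (t {a, l}) (t {l})"
      "drawn_as_arc G p \<gamma> {ed {l} b} (t {l}) (t {b, l})"
      "drawn_as_arc G p \<gamma> {ed {b} l} (t {b, l}) (t {b})"
      using l' sub ends[OF l] ed(1) unfolding edge_ends_def
      by (auto intro!: drawn_as_arc_single[OF emb wf])
    note join = drawn_as_arc_join[OF emb wf]
    show ?thesis
      unfolding F_def
      by (rule join[OF s(1) join[OF s(2) join[OF s(3) s(4)]]]; unfold edge_ends_Un ends[OF l];
          use l' sub dist in \<open>auto simp: doubleton_eq_iff\<close>)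
  qed
  then have "\<forall>l. \<exists>g. l \<in> {i, j, k} \<longrightarrow>
      arc g \<and> pathstart g = p (t {a}) \<and> pathfinish g = p (t {b}) \<and> path_image g = drawing \<gamma> (F l)"
    unfolding drawn_as_arc_def by blast
  from choice[OF this] obtain g where g': "\<forall>l. l \<in> {i, j, k} \<longrightarrow> arc (g l) \<and>
      pathstart (g l) = p (t {a}) \<and> pathfinish (g l) = p (t {b}) \<and> path_image (g l) = drawing \<gamma> (F l)" ..
  have g: "arc (g l)" "pathstart (g l) = p (t {a})" "pathfinish (g l) = p (t {b})"
      "path_image (g l) = drawing \<gamma> (F l)" if "l \<in> {i, j, k}" for l
    using mp[OF spec[OF g'] that] by auto
  define R where "R l = drawing \<gamma> {ed {} l}" for l
  have R_arc: "ed {} l \<in> arcs G" if "l \<in> {i, j, k}" for l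
    using that sub ed(1)[of "{}" l] by auto
  show False
  proof (rule theta_curve_no_common_accessible_point[OF dist(2), of g "p (t {a})" "p (t {b})" R "p (t {})"])
    fix l assume l: "l \<in> {i, j, k}"
    then have l': "l \<in> I" "l \<noteq> a" "l \<noteq> b" using sub dist by auto
    show "arc (g l) \<and> pathstart (g l) = p (t {a}) \<and> pathfinish (g l) = p (t {b})"
      using g[OF l] by simp
    have "simple_path (\<gamma> (ed {} l))"
      using emb R_arc[OF l] unfolding planar_embedding_def by auto
    then show "topological_space_class.connected (R l) \<and> p (t {}) \<in> R l"
      using planar_embedding_ends_in_drawing[OF emb, of "{ed {} l}"] R_arc[OF l] ends(5)[OF l]
      by (auto simp: R_def drawing_def connected_simple_path_image)
    have "p (t {l}) \<in> R l"
      using planar_embedding_ends_in_drawing[OF emb, of "{ed {} l}"] R_arc[OF l] ends(5)[OF l]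
      by (auto simp: R_def)
    moreover have "p (t {l}) \<in> path_image (g l)"
      using planar_embedding_ends_in_drawing[OF emb F_arcs[OF l]] ends_F[OF l] g(4)[OF l] by auto
    moreover have "edge_ends G (F l) \<subseteq> verts G"
      using F_arcs[OF l] wf by (auto simp: edge_ends_def wf_digraph.tail_in_verts wf_digraph.head_in_verts)
    then have "p (t {l}) \<noteq> p (t {a})" "p (t {l}) \<noteq> p (t {b})"
      using l' sub unfolding ends_F[OF l] by (simp_all add: inj_on_eq_iff[OF p_inj])
    ultimately show "R l \<inter> (path_image (g l) - {p (t {a}), p (t {b})}) \<noteq> {}" by blast
    fix m assume m: "m \<in> {i, j, k}" and lm: "l \<noteq> m"
    then have m': "m \<in> I" "m \<noteq> a" "m \<noteq> b" using sub dist by auto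
    have "t {a, l} \<notin> edge_ends G (F m)" "t {b, l} \<notin> edge_ends G (F m)"
      unfolding ends_F[OF m] using l' m' lm sub dist by (auto simp: doubleton_eq_iff)
    then have "F l \<inter> F m = {}"
      using mid_F[OF l] ends_mono[of _ "F m"] by blast
    moreover have "edge_ends G (F l) \<inter> edge_ends G (F m) \<subseteq> {t {a}, t {b}}"
      unfolding ends_F[OF l] ends_F[OF m] using l' m' lm sub dist by (auto simp: doubleton_eq_iff)
    ultimately show "path_image (g l) \<inter> path_image (g m) \<subseteq> {p (t {a}), p (t {b})}"
      using planar_embedding_drawing_Int[OF emb wf F_arcs[OF l] F_arcs[OF m]]
      unfolding g(4)[OF l] g(4)[OF m] by blast
    have disj: "edge_ends G {ed {} l} \<inter> edge_ends G (F m) = {}"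
      unfolding ends(5)[OF l] ends_F[OF m] using l' m' lm sub dist by auto
    moreover have "{ed {} l} \<inter> F m = {}"
      using disj ends_mono[of "ed {} l" "F m"] ends(5)[OF l] by auto
    ultimately show "R l \<inter> path_image (g m) = {}"
      using planar_embedding_drawing_Int[OF emb wf _ F_arcs[OF m], of "{ed {} l}"] R_arc[OF l]
      unfolding g(4)[OF m] R_def by auto
  qed
qed

section \<open>Squares in the skeleton of a higher-rank graph\<close>

lemma (in k_graph) singly_connected_unique:
  assumes "singly_connected \<Lambda>" "x \<in> mor \<Lambda>" "y \<in> mor \<Lambda>" "rng \<Lambda> x = rng \<Lambda> y" "src \<Lambda> x = src \<Lambda> y"
  shows "x = y"
proof -
  let ?M = "{z \<in> mor \<Lambda>. rng \<Lambda> z = rng \<Lambda> x \<and> src \<Lambda> z = src \<Lambda> x}"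
  have "rng \<Lambda> x \<in> objects \<Lambda>" "src \<Lambda> x \<in> objects \<Lambda>"
    using assms(2) objects_eq_identities by auto
  then have "finite ?M \<and> card ?M \<le> 1"
    using assms(1) unfolding singly_connected_def by blast
  then have "\<forall>a \<in> ?M. \<forall>b \<in> ?M. a = b"
    using card_le_Suc0_iff_eq[of ?M] unfolding One_nat_def by blast
  moreover have "x \<in> ?M" "y \<in> ?M" using assms(2-5) by simp_all
  ultimately show ?thesis by blast
qed

lemma (in k_graph) wf_digraph_skeleton: "wf_digraph (skeleton \<Lambda>)"
  using objects_eq_identities
  by unfold_locales (auto simp: skeleton_def edges_def deg_class_def)

text \<open>
  The degree \<open>\<Sum>i\<in>S. axis i 1\<close> of a morphism that contains every colour in \<open>S\<close> exactly once and no
  other colour.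
\<close>

definition square_free_degree :: "'k::finite set \<Rightarrow> nat ^ 'k" where
  "square_free_degree S = (\<chi> i. of_bool (i \<in> S))"

lemma square_free_degree_inject: "square_free_degree S = square_free_degree S' \<longleftrightarrow> S = S'"
  by (auto simp: square_free_degree_def vec_eq_iff)

lemma square_free_degree_simps:
  "square_free_degree {} = 0" "square_free_degree {i} = axis i 1"
  "i \<noteq> j \<Longrightarrow> square_free_degree {i, j} = axis i 1 + axis j 1"
  by (auto simp: square_free_degree_def vec_eq_iff axis_def)

text \<open>
  For each set \<open>S\<close> of at most two emitted colours there is a morphism \<open>L S\<close> with range \<open>v\<close> whose degree
  is the indicator of \<open>S\<close>: the identity, an edge, or the diagonal of a commuting square supplied by
  local convexity. Its source is \<open>t S\<close>. By single connectedness the source determines the morphism,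
  hence its degree and \<open>S\<close>, so all these vertices are distinct.
\<close>

lemma (in k_graph) two_layers_of_cube_in_skeleton:
  assumes sc: "singly_connected \<Lambda>" and lc: "locally_convex \<Lambda>" and v: "v \<in> objects \<Lambda>"
  obtains t where "inj_on t {S. S \<subseteq> emitted_colours \<Lambda> v \<and> card S \<le> 2}"
    and "\<And>S i. \<lbrakk>S \<subseteq> emitted_colours \<Lambda> v; card S \<le> 1; i \<in> emitted_colours \<Lambda> v - S\<rbrakk>
      \<Longrightarrow> \<exists>e \<in> arcs (skeleton \<Lambda>).
        {tail (skeleton \<Lambda>) e, head (skeleton \<Lambda>) e} = {t S, t (insert i S)}"
proof -
  let ?I = "emitted_colours \<Lambda> v"
  obtain x where "x \<in> mor \<Lambda>" "v = rng \<Lambda> x" using v objects_eq_identities by auto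
  then have v': "v \<in> mor \<Lambda>" "rng \<Lambda> v = v" "src \<Lambda> v = v" "deg \<Lambda> v = 0"
    by (auto simp: rng_closed rng_rng src_rng deg_rng)
  have "\<forall>i. \<exists>e. i \<in> ?I \<longrightarrow> e \<in> edges \<Lambda> i \<and> rng \<Lambda> e = v"
    by (auto simp: emitted_colours_def)
  then obtain \<epsilon> where \<epsilon>: "\<epsilon> i \<in> edges \<Lambda> i" "rng \<Lambda> (\<epsilon> i) = v" if "i \<in> ?I" for i by metis
  let ?Q = "\<lambda>S y. y \<in> mor \<Lambda> \<and> rng \<Lambda> y = v \<and> deg \<Lambda> y = square_free_degree S \<and>
      (\<forall>i \<in> S. \<exists>f \<in> (\<Union>j. edges \<Lambda> j). rng \<Lambda> f = src \<Lambda> (\<epsilon> i) \<and> src \<Lambda> f = src \<Lambda> y)"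
  have "\<exists>y. ?Q S y"
    if S: "S \<subseteq> ?I" "card S = 2" for S
  proof -
    obtain i j where ij: "S = {i, j}" "i \<noteq> j" using S by (auto simp: card_2_iff)
    then have "i \<in> ?I" "j \<in> ?I" using S by auto
    note \<epsilon>' = \<epsilon>[OF this(1)] \<epsilon>[OF this(2)]
    then obtain e' f' where *: "e' \<in> edges \<Lambda> i" "f' \<in> edges \<Lambda> j"
      "rng \<Lambda> e' = src \<Lambda> (\<epsilon> j)" "rng \<Lambda> f' = src \<Lambda> (\<epsilon> i)" "cmp \<Lambda> (\<epsilon> i) f' = cmp \<Lambda> (\<epsilon> j) e'"
      using lc ij(2) unfolding locally_convex_def by metis
    have mor: "\<epsilon> i \<in> mor \<Lambda>" "\<epsilon> j \<in> mor \<Lambda>" "e' \<in> mor \<Lambda>" "f' \<in> mor \<Lambda>"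
      "deg \<Lambda> (\<epsilon> i) = axis i 1" "deg \<Lambda> f' = axis j 1"
      using \<epsilon>' * by (auto simp: edges_def deg_class_def)
    let ?y = "cmp \<Lambda> (\<epsilon> i) f'"
    have "?y \<in> mor \<Lambda>" "rng \<Lambda> ?y = v" "deg \<Lambda> ?y = square_free_degree S" "src \<Lambda> f' = src \<Lambda> ?y"
      using mor *(1-4) \<epsilon>' ij by (simp_all add: cmp_closed rng_cmp src_cmp deg_cmp square_free_degree_simps)
    moreover have "src \<Lambda> e' = src \<Lambda> ?y"
      unfolding *(5) using mor *(3) by (simp add: src_cmp)
    ultimately show ?thesis
      using * ij by (intro exI[of _ ?y]) auto
  qed
  then have "\<forall>S. \<exists>y. S \<subseteq> ?I \<and> card S = 2 \<longrightarrow> ?Q S y"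
    by blast
  from choice[OF this] obtain M where M': "\<forall>S. S \<subseteq> ?I \<and> card S = 2 \<longrightarrow> ?Q S (M S)" ..
  have M: "?Q S (M S)" if "S \<subseteq> ?I" "card S = 2" for S
    by (rule mp[OF spec[OF M']]) (use that in simp)
  define L where "L S = (if S = {} then v else if card S = 1 then \<epsilon> (the_elem S) else M S)" for S
  have L_simps: "L {} = v" "L {i} = \<epsilon> i" "i \<noteq> j \<Longrightarrow> L {i, j} = M {i, j}" for i j
    by (simp_all add: L_def)
  have L: "L S \<in> mor \<Lambda> \<and> rng \<Lambda> (L S) = v \<and> deg \<Lambda> (L S) = square_free_degree S"
    if S: "S \<subseteq> ?I" "card S \<le> 2" for S
  proof -
    consider "S = {}" | i where "S = {i}" | "card S = 2"
      using S(2) by (metis card_1_singletonE card_0_eq finite le_SucE le_zero_eq numeral_2_eq_2 One_nat_def)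
    then show ?thesis
    proof cases
      case 1
      then show ?thesis using v' by (simp add: L_simps square_free_degree_simps)
    next
      case (2 i)
      then show ?thesis using \<epsilon>[of i] S
        by (auto simp: L_simps square_free_degree_simps edges_def deg_class_def)
    next
      case 3
      then have "L S = M S" by (auto simp: L_def)
      then show ?thesis using M[OF S(1) 3] by simp
    qed
  qed
  show thesis
  proof (rule that)
    show "inj_on (\<lambda>S. src \<Lambda> (L S)) {S. S \<subseteq> ?I \<and> card S \<le> 2}"
    proof (rule inj_onI)
      fix S S' assume "S \<in> {S. S \<subseteq> ?I \<and> card S \<le> 2}" "S' \<in> {S. S \<subseteq> ?I \<and> card S \<le> 2}"
        and eq: "src \<Lambda> (L S) = src \<Lambda> (L S')"
      then have S: "S \<subseteq> ?I" "card S \<le> 2" "S' \<subseteq> ?I" "card S' \<le> 2" by simp_all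
      have "L S = L S'"
        by (rule singly_connected_unique[OF sc]) (use eq L[OF S(1,2)] L[OF S(3,4)] in simp_all)
      then show "S = S'"
        using L[OF S(1,2)] L[OF S(3,4)] square_free_degree_inject by metis
    qed
  next
    fix S i assume S: "S \<subseteq> ?I" "card S \<le> 1" "i \<in> ?I - S"
    consider "S = {}" | j where "S = {j}"
      using S(2) by (auto simp: le_Suc_eq card_1_singleton_iff)
    then show "\<exists>e \<in> arcs (skeleton \<Lambda>).
        {tail (skeleton \<Lambda>) e, head (skeleton \<Lambda>) e} = {src \<Lambda> (L S), src \<Lambda> (L (insert i S))}"
    proof cases
      case 1
      then show ?thesis
        using \<epsilon>[of i] S v' by (intro bexI[of _ "\<epsilon> i"]) (auto simp: skeleton_def L_simps)
    next
      case (2 j)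
      then obtain f where "f \<in> (\<Union>j. edges \<Lambda> j)" "rng \<Lambda> f = src \<Lambda> (\<epsilon> j)" "src \<Lambda> f = src \<Lambda> (M {i, j})"
        using M[of "{i, j}"] S by auto
      then show ?thesis
        using 2 S by (intro bexI[of _ f]) (auto simp: skeleton_def L_simps)
    qed
  qed
qed

theorem lemma4p2:
  fixes \<Lambda> :: "('a, 'k::finite) rank_graph" and v\<^sub>0 :: 'a
  assumes "k_graph \<Lambda>"
    and "singly_connected \<Lambda>"
    and "locally_convex \<Lambda>"
    and "v\<^sub>0 \<in> objects \<Lambda>"
    and "card (emitted_colours \<Lambda> v\<^sub>0) \<ge> 5"
  shows "contains_complete_subdivision 5 (underlying_graph (skeleton \<Lambda>)) \<and> \<not> planar (skeleton \<Lambda>)"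
proof
  interpret k_graph \<Lambda> by fact
  let ?I = "emitted_colours \<Lambda> v\<^sub>0"
  obtain t where inj: "inj_on t {S. S \<subseteq> ?I \<and> card S \<le> 2}"
    and adj: "\<And>S i. \<lbrakk>S \<subseteq> ?I; card S \<le> 1; i \<in> ?I - S\<rbrakk> \<Longrightarrow> \<exists>e \<in> arcs (skeleton \<Lambda>).
      {tail (skeleton \<Lambda>) e, head (skeleton \<Lambda>) e} = {t S, t (insert i S)}"
    by (fact two_layers_of_cube_in_skeleton[OF assms(2-4)])
  show "\<not> planar (skeleton \<Lambda>)"
    using not_planar_if_two_layers_of_cube[OF wf_digraph_skeleton assms(5) inj adj] .
  obtain J where J: "J \<subseteq> ?I" "card J = 5"
    using assms(5) by (meson obtain_subset_with_card_n)
  show "contains_complete_subdivision 5 (underlying_graph (skeleton \<Lambda>))"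
  proof (rule contains_complete_subdivisionI[OF wf_digraph_skeleton, of J _ "\<lambda>i. t {i}" t])
    have t_eq: "t S = t S' \<longleftrightarrow> S = S'" if "S \<subseteq> J" "card S \<le> 2" "S' \<subseteq> J" "card S' \<le> 2" for S S'
      using inj_on_eq_iff[OF inj] that J(1) by auto
    show "inj_on (\<lambda>i. t {i}) J" "inj_on t {S. S \<subseteq> J \<and> card S = 2}"
      by (auto intro!: inj_onI simp: t_eq)
    show "(\<lambda>i. t {i}) ` J \<inter> t ` {S. S \<subseteq> J \<and> card S = 2} = {}"
      by (auto simp: t_eq)
    fix i S assume "i \<in> S" "S \<subseteq> J" "card S = 2"
    moreover from this obtain j where "S = {i, j}" "i \<noteq> j" by (auto simp: card_2_iff)
    ultimately show "\<exists>e \<in> arcs (skeleton \<Lambda>).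
        {tail (skeleton \<Lambda>) e, head (skeleton \<Lambda>) e} = {t {i}, t S}"
      using adj[of "{i}" j] J(1) by (auto simp: insert_commute)
  qed (use J in simp_all)
qed

end
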